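(* Let $X$ be a metric space with $n$ points, $n$ even, $k=\frac n2-1$, given by its $n\times n$ distance matrix. The cost (number of elementary operations) of computing $t_b(X)$ and $t_d(X)$ is $O(n^2)$.
   Context: For a finite metric space $(X,d_X)$ with at least two points and $x\in X$, choose distinct $x_1,x_2\in X$ with $d_X(x,x_1)\ge d_X(x,x_2)\ge d_X(x,a)$ for all $a\in X\setminus\{x_1,x_2\}$, and set $t_d(x):=d_X(x,x_1)$, $t_b(x):=d_X(x,x_2)$. Define $t_b(X):=\max_{x\in X}t_b(x)$ and $t_d(X):=\min_{x\in X}t_d(x)$. Cost is measured in number of elementary operations (comparisons/look-ups of matrix entries). *)

theory Defs
  imports
    "HOL-Analysis.Abstract_Metric_Spaces"
    "HOL-Library.Landau_Symbols"
    "Jordan_Normal_Form.Matrix"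
begin

text \<open>
  In \<open>farthest_two X d x x1 x2\<close>, the points \<open>x1\<close> and \<open>x2\<close> need not differ from \<open>x\<close>
  (if \<open>X\<close> has exactly two points, one of them is \<open>x\<close>). The choice is not unique, but the
  two distances do not depend on it.
\<close>

definition farthest_two :: "'a set \<Rightarrow> ('a \<Rightarrow> 'a \<Rightarrow> real) \<Rightarrow> 'a \<Rightarrow> 'a \<Rightarrow> 'a \<Rightarrow> bool" where
  "farthest_two X d x x1 x2 \<longleftrightarrow>
     x1 \<in> X \<and> x2 \<in> X \<and> x1 \<noteq> x2 \<and> d x x1 \<ge> d x x2 \<and> (\<forall>a\<in>X - {x1, x2}. d x x2 \<ge> d x a)"

definition choose_two :: "'a set \<Rightarrow> ('a \<Rightarrow> 'a \<Rightarrow> real) \<Rightarrow> 'a \<Rightarrow> 'a \<times> 'a" where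
  "choose_two X d x = (SOME (x1, x2). farthest_two X d x x1 x2)"

definition td_point :: "'a set \<Rightarrow> ('a \<Rightarrow> 'a \<Rightarrow> real) \<Rightarrow> 'a \<Rightarrow> real" where
  "td_point X d x = d x (fst (choose_two X d x))"

definition tb_point :: "'a set \<Rightarrow> ('a \<Rightarrow> 'a \<Rightarrow> real) \<Rightarrow> 'a \<Rightarrow> real" where
  "tb_point X d x = d x (snd (choose_two X d x))"

definition tb :: "'a set \<Rightarrow> ('a \<Rightarrow> 'a \<Rightarrow> real) \<Rightarrow> real" where
  "tb X d = Max (tb_point X d ` X)"

definition td :: "'a set \<Rightarrow> ('a \<Rightarrow> 'a \<Rightarrow> real) \<Rightarrow> real" where
  "td X d = Min (td_point X d ` X)"

definition distance_matrix :: "('a \<Rightarrow> 'a \<Rightarrow> real) \<Rightarrow> nat \<Rightarrow> (nat \<Rightarrow> 'a) \<Rightarrow> real mat" where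
  "distance_matrix d n p = mat n n (\<lambda>(i, j). d (p i) (p j))"

text \<open>
  The model of computation: while programs over index registers (natural numbers) and value
  registers (reals), with a read-only matrix. Value registers can only be filled by matrix
  look-ups or copying, and values can only be inspected by comparing two registers. Index
  registers can be cleared, incremented, copied and compared. Every assignment, look-up,
  \<open>Skip\<close> and evaluation of a comparison costs one elementary operation, so
  loop administration is charged too. A look-up outside the matrix gets stuck.
\<close>

datatype test =
    Index_Less nat nat
  | Value_Less nat nat

datatype prog =
    Skip
  | Clear nat
  | Incr nat
  | Copy_Index nat nat
  | Copy_Value nat nat
  | Look_Up nat nat nat
  | Seq prog prog
  | If_Then_Else test prog prog
  | While_Do test prog

datatype state = State (index_reg: "nat \<Rightarrow> nat") (value_reg: "nat \<Rightarrow> real")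

fun holds :: "test \<Rightarrow> state \<Rightarrow> bool" where
  "holds (Index_Less a b) (State f g) \<longleftrightarrow> f a < f b"
| "holds (Value_Less a b) (State f g) \<longleftrightarrow> g a < g b"

text \<open>
  \<open>exec D c s t s'\<close>: on the matrix \<open>D\<close>, the program \<open>c\<close> started in state \<open>s\<close> terminates in
  state \<open>s'\<close> after exactly \<open>t\<close> elementary operations. The destination register of an
  assignment is its first argument.
\<close>

inductive exec :: "real mat \<Rightarrow> prog \<Rightarrow> state \<Rightarrow> nat \<Rightarrow> state \<Rightarrow> bool" for D where
  Skip: "exec D Skip s 1 s"
| Clear: "exec D (Clear a) (State f g) 1 (State (f(a := 0)) g)"
| Incr: "exec D (Incr a) (State f g) 1 (State (f(a := f a + 1)) g)"
| Copy_Index: "exec D (Copy_Index a b) (State f g) 1 (State (f(a := f b)) g)"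
| Copy_Value: "exec D (Copy_Value a b) (State f g) 1 (State f (g(a := g b)))"
| Look_Up: "f i < dim_row D \<Longrightarrow> f j < dim_col D \<Longrightarrow>
    exec D (Look_Up a i j) (State f g) 1 (State f (g(a := D $$ (f i, f j))))"
| Seq: "exec D c1 s t1 s' \<Longrightarrow> exec D c2 s' t2 s'' \<Longrightarrow> exec D (Seq c1 c2) s (t1 + t2) s''"
| If_True: "holds b s \<Longrightarrow> exec D c1 s t s' \<Longrightarrow> exec D (If_Then_Else b c1 c2) s (1 + t) s'"
| If_False: "\<not> holds b s \<Longrightarrow> exec D c2 s t s' \<Longrightarrow> exec D (If_Then_Else b c1 c2) s (1 + t) s'"
| While_True: "holds b s \<Longrightarrow> exec D c s t1 s' \<Longrightarrow> exec D (While_Do b c) s' t2 s'' \<Longrightarrow>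
    exec D (While_Do b c) s (1 + t1 + t2) s''"
| While_False: "\<not> holds b s \<Longrightarrow> exec D (While_Do b c) s 1 s"

inductive_cases exec_cases:
  "exec D Skip s t s'"
  "exec D (Clear a) s t s'"
  "exec D (Incr a) s t s'"
  "exec D (Copy_Index a b) s t s'"
  "exec D (Copy_Value a b) s t s'"
  "exec D (Look_Up a i j) s t s'"
  "exec D (Seq c1 c2) s t s'"
  "exec D (If_Then_Else b c1 c2) s t s'"
  "exec D (While_Do b c) s t s'"

lemma exec_deterministic:
  "exec D c s t s' \<Longrightarrow> exec D c s u s'' \<Longrightarrow> t = u \<and> s' = s''"
proof (induction arbitrary: u s'' rule: exec.induct)
  case (Seq c1 s t1 s' c2 t2 s2)
  from Seq.prems obtain v1 r v2 where "exec D c1 s v1 r" "exec D c2 r v2 s''" "u = v1 + v2"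
    by (rule exec_cases(7))
  with Seq.IH show ?case by metis
next
  case (While_True b s c t1 s' t2 s2)
  from While_True.prems obtain v1 r v2 where
    "exec D c s v1 r" "exec D (While_Do b c) r v2 s''" "u = Suc (v1 + v2)"
    by (rule exec_cases(9)) (use While_True.hyps(1) in simp_all)
  with While_True.IH show ?case by (metis add.assoc plus_1_eq_Suc)
next
  case (If_True b s c1 t s' c2)
  from If_True.prems obtain v where "exec D c1 s v s''" "u = 1 + v"
    by (rule exec_cases(8)) (use If_True.hyps(1) in simp_all)
  with If_True.IH show ?case by metis
next
  case (If_False b s c2 t s' c1)
  from If_False.prems obtain v where "exec D c2 s v s''" "u = 1 + v"
    by (rule exec_cases(8)) (use If_False.hyps(1) in simp_all)
  with If_False.IH show ?case by metis
next
  case (While_False b s c)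
  from While_False.prems show ?case
    by (rule exec_cases(9)) (use While_False.hyps in simp_all)
next
  case (Skip s)
  from Skip.prems show ?case by (rule exec_cases(1)) simp_all
next
  case (Clear a f g)
  from Clear.prems show ?case by (rule exec_cases(2)) simp_all
next
  case (Incr a f g)
  from Incr.prems show ?case by (rule exec_cases(3)) simp_all
next
  case (Copy_Index a b f g)
  from Copy_Index.prems show ?case by (rule exec_cases(4)) simp_all
next
  case (Copy_Value a b f g)
  from Copy_Value.prems show ?case by (rule exec_cases(5)) simp_all
next
  case (Look_Up f i j a g)
  from Look_Up.prems show ?case by (rule exec_cases(6)) simp_all
qed

definition initial_state :: "nat \<Rightarrow> state" where
  "initial_state n = State ((\<lambda>_. 0)(0 := n)) (\<lambda>_. 0)"

text \<open>
  Started with only the size in index register 0, \<open>c\<close> halts on \<open>D\<close> within \<open>m\<close> elementary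
  operations and leaves \<open>x\<close> and \<open>y\<close> in the value registers 0 and 1.
\<close>

definition computes_within :: "prog \<Rightarrow> nat \<Rightarrow> real mat \<Rightarrow> nat \<Rightarrow> real \<Rightarrow> real \<Rightarrow> bool" where
  "computes_within c n D m x y \<longleftrightarrow>
     (\<exists>t s. exec D c (initial_state n) t s \<and> t \<le> m \<and> value_reg s 0 = x \<and> value_reg s 1 = y)"

end

theory Submission
  imports Defs
begin

text \<open>
  One pass over a row keeps its two largest entries; the outer loop maintains the maximum of the
  second largest and the minimum of the largest ones. Since distances are nonnegative, 0 serves
  as the neutral start value of the three maxima. Each matrix entry costs at most six operations.
\<close>

section \<open>Weakest preconditions with cost\<close>

text \<open>Total correctness, with the exact cost passed to the postcondition. Execution is
  deterministic, so one run determines the outcome and the rules below can be equivalences used for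
  rewriting.\<close>

definition wp :: "real mat \<Rightarrow> prog \<Rightarrow> (nat \<Rightarrow> state \<Rightarrow> bool) \<Rightarrow> state \<Rightarrow> bool" where
  "wp D c Q s \<longleftrightarrow> (\<exists>t s'. exec D c s t s' \<and> Q t s')"

lemma wp_mono: "wp D c P s \<Longrightarrow> (\<And>t s'. P t s' \<Longrightarrow> Q t s') \<Longrightarrow> wp D c Q s"
  unfolding wp_def by blast

lemma wp_Skip: "wp D Skip Q s \<longleftrightarrow> Q 1 s"
  unfolding wp_def by (metis exec.Skip exec_cases(1))

lemma wp_Clear: "wp D (Clear a) Q (State f g) \<longleftrightarrow> Q 1 (State (f(a := 0)) g)"
  unfolding wp_def by (metis exec.Clear exec_deterministic)

lemma wp_Incr: "wp D (Incr a) Q (State f g) \<longleftrightarrow> Q 1 (State (f(a := f a + 1)) g)"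
  unfolding wp_def by (metis exec.Incr exec_deterministic)

lemma wp_Copy_Value: "wp D (Copy_Value a b) Q (State f g) \<longleftrightarrow> Q 1 (State f (g(a := g b)))"
  unfolding wp_def by (metis exec.Copy_Value exec_deterministic)

lemma wp_Look_Up:
  "f i < dim_row D \<Longrightarrow> f j < dim_col D \<Longrightarrow>
    wp D (Look_Up a i j) Q (State f g) \<longleftrightarrow> Q 1 (State f (g(a := D $$ (f i, f j))))"
  unfolding wp_def by (metis exec.Look_Up exec_deterministic)

lemma wp_Seq:
  "wp D (Seq c1 c2) Q s \<longleftrightarrow> wp D c1 (\<lambda>t1. wp D c2 (\<lambda>t2. Q (t1 + t2))) s"
  unfolding wp_def by (blast elim: exec_cases(7) intro: exec.Seq)

lemma wp_If:
  "wp D (If_Then_Else b c1 c2) Q s \<longleftrightarrow>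
    (if holds b s then wp D c1 (\<lambda>t. Q (1 + t)) s else wp D c2 (\<lambda>t. Q (1 + t)) s)"
proof (cases "holds b s")
  case True
  then show ?thesis unfolding wp_def
    by (auto elim!: exec_cases(8)) (metis exec.If_True plus_1_eq_Suc)
next
  case False
  then show ?thesis unfolding wp_def
    by (auto elim!: exec_cases(8)) (metis exec.If_False plus_1_eq_Suc)
qed

lemmas wp_simps = wp_Skip wp_Clear wp_Incr wp_Copy_Value wp_Look_Up wp_Seq wp_If

text \<open>Each of the \<open>n\<close> iterations pays one test and at most \<open>m\<close> for
  the body; the final \<open>+ 1\<close> pays for the failing test.\<close>

lemma wp_counting_loop:
  assumes start: "I 0 s"
    and step: "\<And>i s. i < n \<Longrightarrow> I i s \<Longrightarrow> holds b s \<and> wp D c (\<lambda>t s'. t \<le> m \<and> I (Suc i) s') s"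
    and stop: "\<And>s. I n s \<Longrightarrow> \<not> holds b s"
    and post: "\<And>t s'. t \<le> n * Suc m + 1 \<Longrightarrow> I n s' \<Longrightarrow> Q t s'"
  shows "wp D (While_Do b c) Q s"
proof -
  \<comment> \<open>Induction on the number \<open>r\<close> of iterations left; the invariant index
    \<open>n - r\<close> counts those already done.\<close>
  have "I (n - r) s \<Longrightarrow> r \<le> n \<Longrightarrow> wp D (While_Do b c) (\<lambda>t s'. t \<le> r * Suc m + 1 \<and> I n s') s"
    for r s
  proof (induction r arbitrary: s)
    case 0
    then show ?case using stop[of s] exec.While_False[of b s D c] unfolding wp_def by force
  next
    case (Suc r)
    have "holds b s" "wp D c (\<lambda>t s'. t \<le> m \<and> I (n - r) s') s"
      using step[of "n - Suc r" s] Suc.prems by (simp_all add: Suc_diff_Suc)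
    moreover from this(2) obtain t1 s1 where s1: "exec D c s t1 s1" "t1 \<le> m" "I (n - r) s1"
      unfolding wp_def by blast
    moreover obtain t2 s2 where "exec D (While_Do b c) s1 t2 s2" "t2 \<le> r * Suc m + 1" "I n s2"
      using Suc.IH[OF s1(3)] Suc.prems unfolding wp_def by auto
    moreover have "1 + t1 + t2 \<le> Suc r * Suc m + 1"
      using \<open>t1 \<le> m\<close> \<open>t2 \<le> r * Suc m + 1\<close> by simp
    ultimately show ?case unfolding wp_def by (blast intro: exec.While_True)
  qed
  from this[of n s] start have "wp D (While_Do b c) (\<lambda>t s'. t \<le> n * Suc m + 1 \<and> I n s') s"
    by simp
  then show ?thesis using post by (blast intro: wp_mono)
qed

section \<open>The two largest values of a sequence\<close>

primrec largest :: "(nat \<Rightarrow> real) \<Rightarrow> nat \<Rightarrow> real" where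
  "largest f 0 = 0"
| "largest f (Suc j) = max (largest f j) (f j)"

text \<open>The smaller of the new entry and the old largest value competes for second place. Equal
  entries count separately, since distinct points may be equidistant. The recursion mirrors the row
  scan.\<close>

primrec second_largest :: "(nat \<Rightarrow> real) \<Rightarrow> nat \<Rightarrow> real" where
  "second_largest f 0 = 0"
| "second_largest f (Suc j) = max (second_largest f j) (min (largest f j) (f j))"

text \<open>Lets the program move the old largest value to second place without a further
  comparison.\<close>

lemma second_largest_le_largest: "second_largest f j \<le> largest f j"
  by (induction j) auto

text \<open>By induction: a new index takes first place, second place or neither. The start is
  \<open>j = 2\<close> because two distinct indices are required.\<close>

lemma two_largest_witnesses:
  assumes nonneg: "\<And>a. 0 \<le> f a" and "2 \<le> j"
  shows "\<exists>a<j. \<exists>b<j. a \<noteq> b \<and> f a = largest f j \<and> f b = second_largest f j \<and>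
    (\<forall>e<j. e \<noteq> a \<longrightarrow> e \<noteq> b \<longrightarrow> f e \<le> f b)"
  using \<open>2 \<le> j\<close>
proof (induction j rule: nat_induct_at_least)
  case base
  \<comment> \<open>Nonnegativity makes the start value 0 disappear from both maxima once two
    entries have been read.\<close>
  have f01: "0 \<le> f 0" "0 \<le> f 1" using nonneg by auto
  show ?case
  proof (cases "f 0 < f 1")
    case True
    then show ?thesis using f01
      by (intro exI[of _ 1] conjI exI[of _ 0]) (auto simp: numeral_2_eq_2 less_Suc_eq)
  next
    case False
    then show ?thesis using f01
      by (intro exI[of _ 0] conjI exI[of _ 1]) (auto simp: numeral_2_eq_2 less_Suc_eq)
  qed
next
  case (Suc j)
  then obtain a b where ab: "a < j" "b < j" "a \<noteq> b" "f a = largest f j" "f b = second_largest f j"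
    "\<And>e. e < j \<Longrightarrow> e \<noteq> a \<Longrightarrow> e \<noteq> b \<Longrightarrow> f e \<le> f b" by blast
  have ba: "f b \<le> f a" using second_largest_le_largest[of f j] ab by simp
  \<comment> \<open>The new index pushes \<open>a\<close> to second place, replaces
    \<open>b\<close>, or changes nothing.\<close>
  consider "f a < f j" | "f j \<le> f a" "f b < f j" | "f j \<le> f b" by linarith
  then show ?case
  proof cases
    case 1
    then have "largest f (Suc j) = f j" "second_largest f (Suc j) = f a"
      using ab(4,5) ba by simp_all
    moreover have "f e \<le> f a" if "e < Suc j" "e \<noteq> j" "e \<noteq> a" for e
      using that ab(6)[of e] ba by (cases "e = b") auto
    ultimately show ?thesis using ab(1)
      by (intro exI[of _ j] conjI exI[of _ a]) auto
  next
    case 2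
    then have "largest f (Suc j) = f a" "second_largest f (Suc j) = f j"
      using ab(4,5) by simp_all
    moreover have "f e \<le> f j" if "e < Suc j" "e \<noteq> a" "e \<noteq> j" for e
      using that ab(6)[of e] 2 by (cases "e = b") auto
    ultimately show ?thesis using ab(1)
      by (intro exI[of _ a] conjI exI[of _ j]) auto
  next
    case 3
    then have "largest f (Suc j) = f a" "second_largest f (Suc j) = f b"
      using ab(4,5) ba by simp_all
    moreover have "f e \<le> f b" if "e < Suc j" "e \<noteq> a" "e \<noteq> b" for e
      using that ab(6)[of e] 3 by (cases "e = j") auto
    ultimately show ?thesis using ab(1-3)
      by (intro exI[of _ a] conjI exI[of _ b]) auto
  qed
qed

section \<open>Independence of the choice of farthest points\<close>

lemma farthest_two_unique:
  assumes "farthest_two X d x x1 x2" "farthest_two X d x y1 y2"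
  shows "d x x1 = d x y1" "d x x2 = d x y2"
proof -
  \<comment> \<open>Distinct \<open>z1\<close> and \<open>z2\<close> cannot both be
    \<open>w1\<close>, so the smaller of their distances is at most \<open>d x w2\<close>.
    Exchanging the two pairs gives the reverse inequalities.\<close>
  have le: "d x z1 \<le> d x w1 \<and> d x z2 \<le> d x w2"
    if "farthest_two X d x w1 w2" "farthest_two X d x z1 z2" for w1 w2 z1 z2
  proof -
    have w: "d x w2 \<le> d x w1" "\<And>a. a \<in> X \<Longrightarrow> a = w1 \<or> a = w2 \<or> d x a \<le> d x w2"
      using that(1) unfolding farthest_two_def by blast+
    have z: "z1 \<in> X" "z2 \<in> X" "z1 \<noteq> z2" "d x z2 \<le> d x z1"
      using that(2) unfolding farthest_two_def by blast+
    show ?thesis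
      using w(1) w(2)[OF z(1)] w(2)[OF z(2)] z(3,4) by auto
  qed
  show "d x x1 = d x y1" "d x x2 = d x y2"
    using le[OF assms] le[OF assms(2,1)] by auto
qed

text \<open>Removes \<open>SOME\<close>: the distances are the same for every admissible pair, so
  any explicit one may be used.\<close>

lemma td_tb_point_eq:
  assumes "farthest_two X d x x1 x2"
  shows "td_point X d x = d x x1" "tb_point X d x = d x x2"
proof -
  have "case choose_two X d x of (y1, y2) \<Rightarrow> farthest_two X d x y1 y2"
    unfolding choose_two_def by (rule someI[of _ "(x1, x2)"]) (simp add: assms)
  then have "farthest_two X d x (fst (choose_two X d x)) (snd (choose_two X d x))"
    by (simp add: case_prod_unfold)
  from farthest_two_unique[OF this assms]
  show "td_point X d x = d x x1" "tb_point X d x = d x x2"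
    by (simp_all add: td_point_def tb_point_def)
qed

text \<open>The witnessing indices become an admissible pair of points under \<open>p\<close>;
  injectivity keeps the points distinct.\<close>

lemma td_tb_point_row:
  assumes nonneg: "\<And>y. 0 \<le> d x y" and p: "bij_betw p {..<n} X" and "2 \<le> n"
  shows "td_point X d x = largest (\<lambda>j. d x (p j)) n"
    and "tb_point X d x = second_largest (\<lambda>j. d x (p j)) n"
proof -
  let ?f = "\<lambda>j. d x (p j)"
  obtain a b where ab: "a < n" "b < n" "a \<noteq> b" "?f a = largest ?f n" "?f b = second_largest ?f n"
    "\<And>e. e < n \<Longrightarrow> e \<noteq> a \<Longrightarrow> e \<noteq> b \<Longrightarrow> ?f e \<le> ?f b"
    using two_largest_witnesses[of ?f n] nonneg \<open>2 \<le> n\<close> by blast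
  have "X = p ` {..<n}" and inj: "inj_on p {..<n}"
    using p by (auto simp: bij_betw_def)
  moreover have "p a \<noteq> p b" using ab inj by (auto dest: inj_onD)
  ultimately have "farthest_two X d x (p a) (p b)"
    using ab second_largest_le_largest[of ?f n] unfolding farthest_two_def by auto
  from td_tb_point_eq[OF this] ab
  show "td_point X d x = largest ?f n" "tb_point X d x = second_largest ?f n" by simp_all
qed

section \<open>The program\<close>

text \<open>
  Index registers: 0 holds the size, 1 the row, 2 the column, and 3 stays zero.
  Value registers: 0 and 1 are the results, 2 and 3 the two largest entries of the current row,
  4 the current entry, and 5 stays zero.
\<close>

definition scan_entry :: prog where
  "scan_entry =
     Seq (Look_Up 4 1 2)
    (Seq (If_Then_Else (Value_Less 2 4)
            (Seq (Copy_Value 3 2) (Copy_Value 2 4))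
            (If_Then_Else (Value_Less 3 4) (Copy_Value 3 4) Skip))
         (Incr 2))"

text \<open>Value registers cannot be assigned constants, so the start values are copied from
  register 5, which stays zero.\<close>

definition scan_row :: prog where
  "scan_row =
     Seq (Clear 2) (Seq (Copy_Value 2 5) (Seq (Copy_Value 3 5)
       (While_Do (Index_Less 2 0) scan_entry)))"

text \<open>A minimum has no neutral start value here. The index test therefore detects row 0, where
  the largest entry is stored unconditionally.\<close>

definition update_results :: prog where
  "update_results =
     Seq (If_Then_Else (Value_Less 0 3) (Copy_Value 0 3) Skip)
    (Seq (If_Then_Else (Index_Less 3 1)
            (If_Then_Else (Value_Less 2 1) (Copy_Value 1 2) Skip)
            (Copy_Value 1 2))
         (Incr 1))"

definition scan_matrix :: prog where
  "scan_matrix = While_Do (Index_Less 1 0) (Seq scan_row update_results)"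

section \<open>Correctness and cost of the program\<close>

lemma wp_scan_row:
  assumes D: "dim_row D = n" "dim_col D = n"
    and s: "index_reg s 0 = n" "index_reg s 1 = i" "i < n" "value_reg s 5 = 0"
  defines "f \<equiv> \<lambda>j. D $$ (i, j)"
  shows "wp D scan_row (\<lambda>t s'. t \<le> 6 * n + 4 \<and>
    index_reg s' 0 = n \<and> index_reg s' 1 = i \<and> index_reg s' 3 = index_reg s 3 \<and>
    value_reg s' 0 = value_reg s 0 \<and> value_reg s' 1 = value_reg s 1 \<and> value_reg s' 5 = 0 \<and>
    value_reg s' 2 = largest f n \<and> value_reg s' 3 = second_largest f n) s"
proof -
  obtain F G where s_eq: "s = State F G" by (cases s)
  define I where "I = (\<lambda>j s'. index_reg s' 0 = n \<and> index_reg s' 1 = i \<and> index_reg s' 2 = j \<and>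
    index_reg s' 3 = F 3 \<and>
    value_reg s' 0 = G 0 \<and> value_reg s' 1 = G 1 \<and> value_reg s' 5 = 0 \<and>
    value_reg s' 2 = largest f j \<and> value_reg s' 3 = second_largest f j)"
  \<comment> \<open>An entry costs 5: the look-up, three operations in the conditional and the
    increment. The loop test makes it 6.\<close>
  have loop: "wp D (While_Do (Index_Less 2 0) scan_entry) (\<lambda>t s'. t \<le> n * 6 + 1 \<and> I n s') s0"
    if "I 0 s0" for s0
  proof (rule wp_counting_loop[where I = I and n = n and m = 5])
    fix j s' assume j: "j < n" "I j s'"
    obtain F' G' where s'_eq: "s' = State F' G'" by (cases s')
    \<comment> \<open>If the entry exceeds the largest value, the \<open>max\<close> in
      \<open>second_largest\<close> reduces to the old largest value, because the second never
      exceeds it.\<close>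
    show "holds (Index_Less 2 0) s' \<and> wp D scan_entry (\<lambda>t s''. t \<le> 5 \<and> I (Suc j) s'') s'"
      using j s D second_largest_le_largest[of f j] unfolding s'_eq I_def
      by (auto simp: scan_entry_def wp_simps f_def)
  next
    fix s' assume "I n s'"
    then show "\<not> holds (Index_Less 2 0) s'" by (cases s') (simp add: I_def)
  qed (use that in simp_all)
  show ?thesis
    unfolding scan_row_def s_eq wp_simps
    by (rule wp_mono[OF loop]) (use s s_eq in \<open>auto simp: I_def\<close>)
qed

lemma wp_scan_matrix:
  assumes D: "dim_row D = n" "dim_col D = n" and "0 < n"
    and u: "\<And>i. i < n \<Longrightarrow> u i = largest (\<lambda>j. D $$ (i, j)) n"
    and v: "\<And>i. i < n \<Longrightarrow> v i = second_largest (\<lambda>j. D $$ (i, j)) n"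
    and v_nonneg: "\<And>i. i < n \<Longrightarrow> 0 \<le> v i"
  shows "wp D scan_matrix (\<lambda>t s. t \<le> n * (6 * n + 11) + 1 \<and>
    value_reg s 0 = Max (v ` {..<n}) \<and> value_reg s 1 = Min (u ` {..<n})) (initial_state n)"
proof -
  \<comment> \<open>Inserting 0 matches the initial register content and avoids \<open>Max\<close>
    of the empty set before the first row.\<close>
  define w where "w = (\<lambda>i. Max (insert 0 (v ` {..<i})))"
  \<comment> \<open>The clause for the minimum is guarded by \<open>0 < i\<close>, since
    \<open>Min\<close> of the empty set is unspecified.\<close>
  define I where "I = (\<lambda>i s. index_reg s 0 = n \<and> index_reg s 1 = i \<and> index_reg s 3 = 0 \<and>
    value_reg s 5 = 0 \<and> value_reg s 0 = w i \<and>
    (0 < i \<longrightarrow> value_reg s 1 = Min (u ` {..<i})))"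
  show ?thesis
    unfolding scan_matrix_def
  proof (rule wp_counting_loop[where I = I and n = n and m = "6 * n + 10"])
    show "I 0 (initial_state n)" by (simp add: I_def w_def initial_state_def)
  next
    fix i s assume i: "i < n" "I i s"
    have less: "holds (Index_Less 1 0) s" using i by (cases s) (simp add: I_def)
    have Max_Suc: "w (Suc i) = max (v i) (w i)"
      by (simp add: w_def lessThan_Suc insert_commute[of 0])
    have Min_Suc: "Min (u ` {..<Suc i}) = (if i = 0 then u i else min (u i) (Min (u ` {..<i})))"
      by (simp add: lessThan_Suc lessThan_empty_iff)
    \<comment> \<open>The row scan costs at most \<open>6 * n + 4\<close> and the update at most 6;
      the outer test adds one more per row.\<close>
    have "wp D scan_row (\<lambda>t. wp D update_results (\<lambda>t' s'. t + t' \<le> 6 * n + 10 \<and> I (Suc i) s')) s"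
    proof (rule wp_mono[OF wp_scan_row[OF D, of s i]])
      fix t s'
      assume s': "t \<le> 6 * n + 4 \<and>
        index_reg s' 0 = n \<and> index_reg s' 1 = i \<and> index_reg s' 3 = index_reg s 3 \<and>
        value_reg s' 0 = value_reg s 0 \<and> value_reg s' 1 = value_reg s 1 \<and> value_reg s' 5 = 0 \<and>
        value_reg s' 2 = largest (\<lambda>j. D $$ (i, j)) n \<and>
        value_reg s' 3 = second_largest (\<lambda>j. D $$ (i, j)) n"
      obtain F G where s'_eq: "s' = State F G" by (cases s')
      show "wp D update_results (\<lambda>t' s'. t + t' \<le> 6 * n + 10 \<and> I (Suc i) s') s'"
        using s' i u[of i] v[of i] unfolding s'_eq I_def Max_Suc Min_Suc
        by (auto simp: update_results_def wp_simps)
    qed (use i in \<open>simp_all add: I_def\<close>)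
    with less show "holds (Index_Less 1 0) s \<and>
        wp D (Seq scan_row update_results) (\<lambda>t s'. t \<le> 6 * n + 10 \<and> I (Suc i) s') s"
      by (simp add: wp_Seq)
  next
    fix s assume "I n s"
    then show "\<not> holds (Index_Less 1 0) s" by (cases s) (simp add: I_def)
  next
    fix t s assume t: "t \<le> n * Suc (6 * n + 10) + 1" and s: "I n s"
    \<comment> \<open>Nonnegative row values make the inserted 0 harmless in the final
      maximum.\<close>
    have "0 \<le> Max (v ` {..<n})"
      using v_nonneg[OF \<open>0 < n\<close>] \<open>0 < n\<close> by (intro order_trans[OF _ Max_ge[of _ "v 0"]]) auto
    then have "w n = Max (v ` {..<n})"
      unfolding w_def using \<open>0 < n\<close> by (subst Max_insert) auto
    with t s \<open>0 < n\<close> show "t \<le> n * (6 * n + 11) + 1 \<and>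
        value_reg s 0 = Max (v ` {..<n}) \<and> value_reg s 1 = Min (u ` {..<n})"
      by (simp add: I_def add.commute)
  qed
qed

section \<open>From matrix rows to the metric space\<close>

text \<open>Matrix entries are known to be distances only for indices below \<open>n\<close>, so
  rows are compared only there.\<close>

lemma largest_cong: "(\<And>j. j < n \<Longrightarrow> f j = g j) \<Longrightarrow> largest f n = largest g n"
  by (induction n) auto

lemma second_largest_cong: "(\<And>j. j < n \<Longrightarrow> f j = g j) \<Longrightarrow> second_largest f n = second_largest g n"
  by (induction n) (auto cong: largest_cong)

lemma second_largest_nonneg: "0 \<le> second_largest f n"
  by (induction n) auto

text \<open>Row \<open>i\<close> lists the distances from \<open>p i\<close>, and \<open>p\<close>
  turns the extrema over \<open>X\<close> into extrema over row indices.\<close>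

lemma computes_within_scan_matrix:
  assumes "\<And>x y. 0 \<le> d x y" and p: "bij_betw p {..<n} X" and "2 \<le> n"
  shows "computes_within scan_matrix n (distance_matrix d n p) (n * (6 * n + 11) + 1)
    (tb X d) (td X d)"
proof -
  let ?D = "distance_matrix d n p"
  let ?u = "\<lambda>i. td_point X d (p i)" and ?v = "\<lambda>i. tb_point X d (p i)"
  note row = td_tb_point_row[OF assms]
  have entry: "?D $$ (i, j) = d (p i) (p j)" if "i < n" "j < n" for i j
    using that by (simp add: distance_matrix_def)
  have "X = p ` {..<n}" using p by (simp add: bij_betw_def)
  then have tb: "tb X d = Max (?v ` {..<n})" and td: "td X d = Min (?u ` {..<n})"
    unfolding tb_def td_def by (simp_all only: image_image)
  have "wp ?D scan_matrix (\<lambda>t s. t \<le> n * (6 * n + 11) + 1 \<and>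
    value_reg s 0 = Max (?v ` {..<n}) \<and> value_reg s 1 = Min (?u ` {..<n})) (initial_state n)"
    using \<open>2 \<le> n\<close>
    by (intro wp_scan_matrix)
      (auto simp: row entry second_largest_nonneg distance_matrix_def
        intro!: largest_cong second_largest_cong)
  then show ?thesis
    unfolding computes_within_def tb td wp_def by blast
qed

theorem proposition4p6:
  "\<exists>(c :: prog) (T :: nat \<Rightarrow> nat).
     (\<lambda>n. real (T n)) \<in> O(\<lambda>n. real n ^ 2) \<and>
     (\<forall>(X :: 'a set) (d :: 'a \<Rightarrow> 'a \<Rightarrow> real) (n :: nat) (k :: nat) (p :: nat \<Rightarrow> 'a).
        Metric_space X d \<and> finite X \<and> card X = n \<and> n \<ge> 2 \<and> even n \<and> real k = real n / 2 - 1 \<and>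
        bij_betw p {..<n} X \<longrightarrow>
        computes_within c n (distance_matrix d n p) (T n) (tb X d) (td X d))"
proof (intro exI[of _ scan_matrix] exI[of _ "\<lambda>n. n * (6 * n + 11) + 1"] conjI allI impI)
  show "(\<lambda>n. real (n * (6 * n + 11) + 1)) \<in> O(\<lambda>n. real n ^ 2)"
  \<comment> \<open>For \<open>n \<ge> 1\<close> both \<open>n\<close> and 1 are at most
    \<open>n ^ 2\<close>, and 18 is \<open>6 + 11 + 1\<close>.\<close>
  proof (rule bigoI[where c = 18], rule eventually_sequentiallyI[where c = 1])
    fix n :: nat assume "1 \<le> n"
    then have "1 \<le> n ^ 2" "n \<le> n ^ 2" by (simp_all add: self_le_power)
    moreover have "n * (6 * n + 11) + 1 = 6 * n ^ 2 + 11 * n + 1"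
      by (simp add: power2_eq_square algebra_simps)
    ultimately have "n * (6 * n + 11) + 1 \<le> 18 * n ^ 2" by linarith
    then show "norm (real (n * (6 * n + 11) + 1)) \<le> 18 * norm (real n ^ 2)"
      by (metis (mono_tags, lifting) norm_of_nat norm_power of_nat_le_iff of_nat_mult
          of_nat_numeral of_nat_power)
  qed
qed (blast intro: computes_within_scan_matrix Metric_space.nonneg)

end
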